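(* Let $f(x)=\frac12 x^T A x-b^T x$ on $\mathbb{R}^n$, where $b\in\mathbb{R}^n$ and $A\in\mathbb{R}^{n\times n}$ is symmetric and positive definite. Let $\{x_k\}$ be iterates of the gradient method $x_{k+1}=x_k-\alpha_k g_k$ with stepsizes $\alpha_k>0$, where $g_k=\nabla f(x_k)$, and let $k\ge 1$ be such that $g_k\neq 0$. Put $s_{k-1}=x_k-x_{k-1}$ and $y_{k-1}=g_k-g_{k-1}$. Then the approximately optimal stepsize $$\alpha_k^{AOS}=\frac{\|g_k\|^2}{\dfrac{\|y_{k-1}\|^2}{s_{k-1}^T y_{k-1}}\left(\|g_k\|^2-\dfrac{(g_k^T s_{k-1})^2}{\|s_{k-1}\|^2}\right)+\dfrac{(g_k^T y_{k-1})^2}{s_{k-1}^T y_{k-1}}}$$ satisfies $$\frac12\,\alpha_k^{BB_2}<\alpha_k^{AOS}<2\,\alpha_k^{BB_1},$$ where $\alpha_k^{BB_1}=\dfrac{\|s_{k-1}\|^2}{s_{k-1}^T y_{k-1}}$ and $\alpha_k^{BB_2}=\dfrac{s_{k-1}^T y_{k-1}}{\|y_{k-1}\|^2}$.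
   Context: $\|\cdot\|$ is the Euclidean norm. The quantities $\alpha_k^{BB_1}$ and $\alpha_k^{BB_2}$ are the Barzilai-Borwein stepsizes. The approximately optimal stepsize (for the gradient method, with search direction $d_k=-g_k$) is the positive minimizer over $\alpha>0$ of the quadratic model $\phi_k(\alpha)=f(x_k)+\alpha g_k^T d_k+\frac12\alpha^2 d_k^T\bar B_k d_k$, i.e. $\alpha_k^{AOS}=-\dfrac{g_k^T d_k}{d_k^T\bar B_k d_k}$, where $$\bar B_k=\frac{\|y_{k-1}\|^2}{s_{k-1}^T y_{k-1}}I-\frac{\|y_{k-1}\|^2}{s_{k-1}^T y_{k-1}}\frac{s_{k-1}s_{k-1}^T}{\|s_{k-1}\|^2}+\frac{y_{k-1}y_{k-1}^T}{s_{k-1}^T y_{k-1}};$$ substituting $d_k=-g_k$ gives the explicit formula in the claim. *)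

theory Defs
  imports "HOL-Analysis.Analysis"
begin

definition sym_pos_def :: "real^'n^'n \<Rightarrow> bool" where
  "sym_pos_def A \<longleftrightarrow> transpose A = A \<and> (\<forall>v. v \<noteq> 0 \<longrightarrow> 0 < v \<bullet> (A *v v))"

definition quadratic :: "real^'n^'n \<Rightarrow> real^'n \<Rightarrow> real^'n \<Rightarrow> real" where
  "quadratic A b x = 1/2 * (x \<bullet> (A *v x)) - b \<bullet> x"

definition outer :: "real^'n \<Rightarrow> real^'n \<Rightarrow> real^'n^'n" where
  "outer u v = (\<chi> i j. u $ i * v $ j)"

text \<open>The Barzilai--Borwein stepsizes, where \<open>s = x\<^sub>k - x\<^sub>k\<^sub>-\<^sub>1\<close> and \<open>y = g\<^sub>k - g\<^sub>k\<^sub>-\<^sub>1\<close>.\<close>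

definition BB1 :: "real^'n \<Rightarrow> real^'n \<Rightarrow> real" where
  "BB1 s y = (norm s)\<^sup>2 / (s \<bullet> y)"

definition BB2 :: "real^'n \<Rightarrow> real^'n \<Rightarrow> real" where
  "BB2 s y = (s \<bullet> y) / (norm y)\<^sup>2"

text \<open>The Hessian approximation: one BFGS update of the scaled identity
  \<open>(\<parallel>y\<parallel>\<^sup>2 / s\<^sup>T y) I\<close>.\<close>

definition B_bar :: "real^'n \<Rightarrow> real^'n \<Rightarrow> real^'n^'n" where
  "B_bar s y =
     ((norm y)\<^sup>2 / (s \<bullet> y)) *\<^sub>R mat 1
     - ((norm y)\<^sup>2 / (s \<bullet> y)) *\<^sub>R ((1 / (norm s)\<^sup>2) *\<^sub>R outer s s)
     + (1 / (s \<bullet> y)) *\<^sub>R outer y y"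

definition quad_model ::
  "(real^'n \<Rightarrow> real) \<Rightarrow> real^'n \<Rightarrow> real^'n \<Rightarrow> real^'n \<Rightarrow> real^'n^'n \<Rightarrow> real \<Rightarrow> real" where
  "quad_model f x g d B a = f x + a * (g \<bullet> d) + 1/2 * a\<^sup>2 * (d \<bullet> (B *v d))"

text \<open>The minimizer of the model over the stepsizes \<open>a > 0\<close>. It exists and is unique as soon as
  \<open>g \<bullet> d < 0 < d \<bullet> (B *v d)\<close>; otherwise \<^const>\<open>arg_min_on\<close> need not have this meaning.\<close>

definition AOS ::
  "(real^'n \<Rightarrow> real) \<Rightarrow> real^'n \<Rightarrow> real^'n \<Rightarrow> real^'n \<Rightarrow> real^'n^'n \<Rightarrow> real" where
  "AOS f x g d B = arg_min_on (quad_model f x g d B) {0<..}"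

end

theory Submission
  imports Defs
begin

text \<open>
  Write \<open>\<beta>(g) = g \<bullet> (B_bar s y *v g)\<close>. Since \<open>d = -g\<close>, the model is a parabola in the stepsize with
  slope \<open>-\<parallel>g\<parallel>\<^sup>2\<close> at \<open>0\<close> and second derivative \<open>\<beta>(g)\<close>, so as soon as \<open>\<beta>(g) > 0\<close> its minimizer is
  \<open>\<parallel>g\<parallel>\<^sup>2 / \<beta>(g)\<close>, the inverse of a Rayleigh quotient of \<open>B_bar s y\<close>. The two estimates therefore amount
  to the bounds
  \<open>(s \<bullet> y) / (2 \<parallel>s\<parallel>\<^sup>2) < \<beta>(g) / \<parallel>g\<parallel>\<^sup>2 < 2 \<parallel>y\<parallel>\<^sup>2 / (s \<bullet> y)\<close>,
  and these hold for every \<open>g \<noteq> 0\<close> and all \<open>s, y\<close> with \<open>s \<bullet> y > 0\<close>.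

  The upper bound is the Cauchy--Schwarz inequality for \<open>g, y\<close> together with dropping a square; both
  losses vanish simultaneously only if \<open>g\<close> is parallel to \<open>y\<close> and orthogonal to \<open>s\<close>, which \<open>s \<bullet> y > 0\<close>
  excludes. For the lower bound, split \<open>g\<close> and \<open>y\<close> into their components along and orthogonal to \<open>s\<close>,
  apply Cauchy--Schwarz to the orthogonal components only, and use \<open>t\<^sup>2 + (t + m)\<^sup>2 \<ge> m\<^sup>2 / 2\<close>.

  The curvature condition \<open>s \<bullet> y > 0\<close> is where the quadratic objective enters: \<open>y = A s\<close> with \<open>A\<close>
  positive definite, and \<open>s \<noteq> 0\<close>, for otherwise the previous gradient, and with it the current one,
  would vanish.
\<close>

lemma arg_min_on_upward_parabola:
  fixes c p q :: real
  assumes "0 < p" and "0 < q"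
  shows "arg_min_on (\<lambda>a. c - a * p + 1/2 * a\<^sup>2 * q) {0<..} = p / q"
proof -
  let ?f = "\<lambda>a. c - a * p + 1/2 * a\<^sup>2 * q"
  have completed_square: "?f a = ?f (p / q) + q / 2 * (a - p / q)\<^sup>2" for a
    using assms by (simp add: field_simps power2_eq_square)
  have above: "?f (p / q) < ?f a" if "a \<noteq> p / q" for a
    using completed_square[of a] that assms by (simp add: zero_less_power2)
  have "is_arg_min ?f (\<lambda>a. a \<in> {0<..}) a \<longleftrightarrow> a = p / q" for a
  proof
    assume "is_arg_min ?f (\<lambda>a. a \<in> {0<..}) a"
    moreover have "p / q \<in> {0<..}" using assms by simp
    ultimately have "\<not> ?f (p / q) < ?f a" by (auto simp: is_arg_min_def)
    then show "a = p / q" using above by blast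
  next
    assume a: "a = p / q"
    have "\<not> ?f z < ?f (p / q)" for z
      using above[of z] by (cases "z = p / q") auto
    then show "is_arg_min ?f (\<lambda>a. a \<in> {0<..}) a"
      unfolding is_arg_min_def a using assms by simp
  qed
  then have "is_arg_min ?f (\<lambda>a. a \<in> {0<..}) = (\<lambda>a. a = p / q)" by blast
  then show ?thesis
    unfolding arg_min_on_def arg_min_def by (simp only: some_eq_trivial)
qed

lemma AOS_steepest_descent:
  fixes g :: "real^'n"
  assumes "g \<noteq> 0" and "0 < g \<bullet> (B *v g)"
  shows "AOS f x g (- g) B = (norm g)\<^sup>2 / (g \<bullet> (B *v g))"
proof -
  have "B *v (- g) = - (B *v g)"
    using matrix_vector_mult_scaleR[of B "-1" g] by simp
  then have model: "quad_model f x g (- g) B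
      = (\<lambda>a. f x - a * (norm g)\<^sup>2 + 1/2 * a\<^sup>2 * (g \<bullet> (B *v g)))"
    by (auto simp: quad_model_def power2_norm_eq_inner)
  show ?thesis
    unfolding AOS_def model using assms by (intro arg_min_on_upward_parabola) auto
qed

lemma outer_mult_vec: "outer u v *v w = (v \<bullet> w) *\<^sub>R u"
  by (simp add: vec_eq_iff outer_def matrix_vector_mult_def inner_vec_def
      sum_distrib_left mult_ac)

lemma B_bar_quadratic_form:
  "v \<bullet> (B_bar s y *v v) =
     (norm y)\<^sup>2 / (s \<bullet> y) * ((norm v)\<^sup>2 - (v \<bullet> s)\<^sup>2 / (norm s)\<^sup>2) + (v \<bullet> y)\<^sup>2 / (s \<bullet> y)"
proof -
  have "v \<bullet> v = (norm v)\<^sup>2" by (rule dot_square_norm)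
  then show ?thesis
    unfolding B_bar_def
    by (simp add: matrix_vector_mult_add_rdistrib matrix_vector_mult_diff_rdistrib
        scaleR_matrix_vector_assoc[symmetric] outer_mult_vec inner_add_right inner_diff_right
        inner_commute power2_eq_square right_diff_distrib)
qed

text \<open>Both discarded terms, \<open>(g \<bullet> s)\<^sup>2\<close> and the defect in Cauchy--Schwarz for \<open>g, y\<close>, can vanish
  together only if \<open>g\<close> is a multiple of \<open>y\<close> that is orthogonal to \<open>s\<close>.\<close>

lemma B_bar_quadratic_form_upper:
  fixes g s y :: "real^'n"
  assumes "g \<noteq> 0" and curv: "0 < s \<bullet> y"
  shows "g \<bullet> (B_bar s y *v g) < 2 * (norm g)\<^sup>2 * (norm y)\<^sup>2 / (s \<bullet> y)"
proof -
  have nz: "s \<noteq> 0" "y \<noteq> 0" using curv by auto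
  have cs: "(g \<bullet> y)\<^sup>2 \<le> (norm g)\<^sup>2 * (norm y)\<^sup>2"
    using Cauchy_Schwarz_ineq[of g y] by (simp add: power2_norm_eq_inner)
  have drop: "0 \<le> (norm y)\<^sup>2 * ((g \<bullet> s)\<^sup>2 / (norm s)\<^sup>2)" by simp
  have "(norm y)\<^sup>2 * ((norm g)\<^sup>2 - (g \<bullet> s)\<^sup>2 / (norm s)\<^sup>2) + (g \<bullet> y)\<^sup>2
      < 2 * (norm g)\<^sup>2 * (norm y)\<^sup>2"
  proof (rule ccontr)
    assume not_less: "\<not> ?thesis"
    have "2 * (norm g)\<^sup>2 * (norm y)\<^sup>2
        = (norm g)\<^sup>2 * (norm y)\<^sup>2 + (norm y)\<^sup>2 * (norm g)\<^sup>2"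
      by simp
    with not_less have eq: "(g \<bullet> y)\<^sup>2 = (norm g)\<^sup>2 * (norm y)\<^sup>2"
      and "(norm y)\<^sup>2 * ((g \<bullet> s)\<^sup>2 / (norm s)\<^sup>2) = 0"
      using cs drop unfolding right_diff_distrib by linarith+
    then have orth: "g \<bullet> s = 0" using nz by simp
    define r where "r = (norm y)\<^sup>2 *\<^sub>R g - (g \<bullet> y) *\<^sub>R y"
    \<comment> \<open>The vector \<open>r\<close> is \<open>\<parallel>y\<parallel>\<^sup>2\<close> times the component of \<open>g\<close> orthogonal to \<open>y\<close>.\<close>
    have "r \<bullet> r = (norm y)\<^sup>2 * ((norm g)\<^sup>2 * (norm y)\<^sup>2 - (g \<bullet> y)\<^sup>2)"
      unfolding power2_norm_eq_inner r_def inner_diff_left inner_diff_right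
      by (simp add: inner_commute power2_eq_square algebra_simps)
    then have "r = 0" using eq by simp
    then have "r \<bullet> s = 0" by simp
    then have "(g \<bullet> y) * (s \<bullet> y) = 0"
      using orth by (simp add: r_def inner_diff_left inner_commute[of y s])
    then have "g \<bullet> y = 0" using curv by simp
    then show False using eq nz assms by simp
  qed
  from divide_strict_right_mono[OF this curv] show ?thesis
    by (simp add: B_bar_quadratic_form add_divide_distrib)
qed

text \<open>Let \<open>p\<close> and \<open>q\<close> be the components of \<open>g\<close> and \<open>y\<close> orthogonal to \<open>s\<close>, so that
  \<open>g \<bullet> y = p \<bullet> q + m\<close> with \<open>m = (g \<bullet> s)(s \<bullet> y) / \<parallel>s\<parallel>\<^sup>2\<close>. After multiplication by \<open>s \<bullet> y\<close> the quadratic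
  form is \<open>\<parallel>y\<parallel>\<^sup>2 \<parallel>p\<parallel>\<^sup>2 + (p \<bullet> q + m)\<^sup>2\<close>. Its first term is at least
  \<open>(p \<bullet> q)\<^sup>2 + \<parallel>p\<parallel>\<^sup>2 (s \<bullet> y)\<^sup>2 / \<parallel>s\<parallel>\<^sup>2\<close>, by Cauchy--Schwarz for \<open>p, q\<close> and Pythagoras for \<open>y\<close>. The square
  \<open>(p \<bullet> q)\<^sup>2\<close> makes up for a possible cancellation in \<open>p \<bullet> q + m\<close>, leaving at least \<open>m\<^sup>2 / 2\<close>, while the
  target is \<open>\<parallel>p\<parallel>\<^sup>2 (s \<bullet> y)\<^sup>2 / (2 \<parallel>s\<parallel>\<^sup>2) + m\<^sup>2 / 2\<close>. This is strict if \<open>p \<noteq> 0\<close>; if \<open>p = 0\<close>, nothing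
  cancels and the full \<open>m\<^sup>2 > 0\<close> is available.\<close>

lemma B_bar_quadratic_form_lower:
  fixes g s y :: "real^'n"
  assumes "g \<noteq> 0" and curv: "0 < s \<bullet> y"
  shows "(norm g)\<^sup>2 * (s \<bullet> y) / (2 * (norm s)\<^sup>2) < g \<bullet> (B_bar s y *v g)"
proof -
  define S where "S = (norm s)\<^sup>2"
  define P where "P = (norm g)\<^sup>2 - (g \<bullet> s)\<^sup>2 / S"
  define m where "m = (g \<bullet> s) * (s \<bullet> y) / S"
  define t where "t = g \<bullet> y - m"
  define p where "p = g - ((g \<bullet> s) / S) *\<^sub>R s"
  define q where "q = y - ((s \<bullet> y) / S) *\<^sub>R s"
  have "s \<noteq> 0" using curv by auto
  then have S: "0 < S" by (simp add: S_def)
  have ss: "s \<bullet> s = S" by (simp add: S_def power2_norm_eq_inner)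
  have gg: "g \<bullet> g = (norm g)\<^sup>2" and yy: "y \<bullet> y = (norm y)\<^sup>2"
    by (simp_all add: power2_norm_eq_inner)
  have pp: "p \<bullet> p = P" and qq: "q \<bullet> q = (norm y)\<^sup>2 - (s \<bullet> y)\<^sup>2 / S" and pq: "p \<bullet> q = t"
    using S by (simp_all add: p_def q_def P_def t_def m_def inner_diff_left inner_diff_right ss gg yy
        inner_commute power2_eq_square field_simps)
  have "0 \<le> P" using pp inner_ge_zero[of p] by simp
  have cs: "t\<^sup>2 \<le> P * ((norm y)\<^sup>2 - (s \<bullet> y)\<^sup>2 / S)"
    using Cauchy_Schwarz_ineq[of p q] by (simp add: pp qq pq)
  \<comment> \<open>By Pythagoras for \<open>g\<close>, the target splits into an orthogonal and a parallel part.\<close>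
  have norm_g: "(norm g)\<^sup>2 * (s \<bullet> y)\<^sup>2 / (2 * S) = P * (s \<bullet> y)\<^sup>2 / S / 2 + m\<^sup>2 / 2"
    using S by (simp add: P_def m_def field_simps power2_eq_square)
  have first: "t\<^sup>2 + P * (s \<bullet> y)\<^sup>2 / S \<le> (norm y)\<^sup>2 * P"
    using cs by (simp add: algebra_simps)
  have gy: "g \<bullet> y = t + m" by (simp add: t_def)
  have "(norm g)\<^sup>2 * (s \<bullet> y)\<^sup>2 / (2 * S) < (norm y)\<^sup>2 * P + (g \<bullet> y)\<^sup>2"
  proof (cases "P = 0")
    case True
    then have "t = 0" using cs by simp
    have "(norm g)\<^sup>2 = (g \<bullet> s)\<^sup>2 / S" using True by (simp add: P_def)
    then have "g \<bullet> s \<noteq> 0" using assms by auto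
    then have "0 < m\<^sup>2" using S curv by (simp add: m_def)
    then show ?thesis using True \<open>t = 0\<close> by (simp add: norm_g gy)
  next
    case False
    then have "0 < P * (s \<bullet> y)\<^sup>2 / S" using \<open>0 \<le> P\<close> S curv by simp
    moreover have "m\<^sup>2 / 2 \<le> t\<^sup>2 + (t + m)\<^sup>2"
      using zero_le_power2[of "2 * t + m"] by (simp add: power2_eq_square algebra_simps)
    ultimately show ?thesis using first by (simp add: norm_g gy)
  qed
  from divide_strict_right_mono[OF this curv]
  have "(norm g)\<^sup>2 * (s \<bullet> y)\<^sup>2 / (2 * S) / (s \<bullet> y) < g \<bullet> (B_bar s y *v g)"
    by (simp add: B_bar_quadratic_form P_def S_def add_divide_distrib)
  then show ?thesis using curv by (simp add: S_def power2_eq_square)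
qed

lemma GDERIV_quadratic:
  assumes "transpose A = A" and deriv: "GDERIV (quadratic A b) x :> g"
  shows "g = A *v x - b"
proof -
  have symm: "x \<bullet> (A *v h) = h \<bullet> (A *v x)" for h
    by (metis assms(1) dot_lmul_matrix inner_commute transpose_matrix_vector)
  have "((\<lambda>x. 1/2 * (x \<bullet> (A *v x)) - b \<bullet> x) has_derivative
          (\<lambda>h. 1/2 * (x \<bullet> (A *v h) + h \<bullet> (A *v x)) - b \<bullet> h)) (at x)"
    by (auto intro!: derivative_eq_intros
        bounded_linear.has_derivative[OF matrix_vector_mul_bounded_linear])
  then have "(quadratic A b has_derivative (\<lambda>h. h \<bullet> (A *v x - b))) (at x)"
    by (simp add: quadratic_def[abs_def] symm inner_diff_right inner_commute)
  with deriv have "(\<lambda>h. h \<bullet> g) = (\<lambda>h. h \<bullet> (A *v x - b))"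
    unfolding gderiv_def by (rule has_derivative_unique)
  then have "h \<bullet> g = h \<bullet> (A *v x - b)" for h by meson
  then show ?thesis by (blast intro: vector_eq_ldot[THEN iffD1])
qed

theorem theorem3p1:
  fixes A :: "real^'n^'n" and b :: "real^'n"
    and x g :: "nat \<Rightarrow> real^'n" and \<alpha> :: "nat \<Rightarrow> real"
    and k :: nat and s y :: "real^'n" and \<alpha>_AOS :: real
  assumes "sym_pos_def A"
    and "\<And>j. GDERIV (quadratic A b) (x j) :> g j"
    and "\<And>j. 0 < \<alpha> j"
    and "\<And>j. x (Suc j) = x j - \<alpha> j *\<^sub>R g j"
    and "1 \<le> k"
    and "g k \<noteq> 0"
    and "s = x k - x (k - 1)"
    and "y = g k - g (k - 1)"
    and "\<alpha>_AOS = AOS (quadratic A b) (x k) (g k) (- g k) (B_bar s y)"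
  shows "\<alpha>_AOS = (norm (g k))\<^sup>2 /
           ((norm y)\<^sup>2 / (s \<bullet> y) * ((norm (g k))\<^sup>2 - (g k \<bullet> s)\<^sup>2 / (norm s)\<^sup>2)
            + (g k \<bullet> y)\<^sup>2 / (s \<bullet> y)) \<and>
         1/2 * BB2 s y < \<alpha>_AOS \<and>
         \<alpha>_AOS < 2 * BB1 s y"
proof -
  have A: "transpose A = A" "\<And>v. v \<noteq> 0 \<Longrightarrow> 0 < v \<bullet> (A *v v)"
    using assms(1) by (auto simp: sym_pos_def_def)
  have grad: "g j = A *v x j - b" for j
    using GDERIV_quadratic[OF A(1) assms(2)] .
  have y: "y = A *v s"
    by (simp add: assms(7,8) grad matrix_vector_mult_diff_distrib)
  have s: "s = - \<alpha> (k - 1) *\<^sub>R g (k - 1)"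
    using assms(4)[of "k - 1"] assms(5,7) by simp
  have "s \<noteq> 0"
  proof
    assume "s = 0"
    then have "g (k - 1) = 0" using s assms(3)[of "k - 1"] by simp
    moreover have "g k = g (k - 1)" using y \<open>s = 0\<close> assms(8) by simp
    ultimately show False using assms(6) by simp
  qed
  then have curv: "0 < s \<bullet> y" using A(2) y by simp
  then have "y \<noteq> 0" by auto
  define \<beta> where "\<beta> = g k \<bullet> (B_bar s y *v g k)"
  have upper: "\<beta> < 2 * (norm (g k))\<^sup>2 * (norm y)\<^sup>2 / (s \<bullet> y)"
    and lower: "(norm (g k))\<^sup>2 * (s \<bullet> y) / (2 * (norm s)\<^sup>2) < \<beta>"
    unfolding \<beta>_def using B_bar_quadratic_form_upper B_bar_quadratic_form_lower assms(6) curv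
    by blast+
  have "0 \<le> (norm (g k))\<^sup>2 * (s \<bullet> y) / (2 * (norm s)\<^sup>2)" using curv by simp
  then have pos: "0 < \<beta>" using lower by linarith
  have aos: "\<alpha>_AOS = (norm (g k))\<^sup>2 / \<beta>"
    using AOS_steepest_descent[of "g k" "B_bar s y"] assms(6,9) pos by (simp add: \<beta>_def)
  have "1/2 * BB2 s y < \<alpha>_AOS"
    using upper pos curv \<open>y \<noteq> 0\<close> by (simp add: aos BB2_def field_simps)
  moreover have "\<alpha>_AOS < 2 * BB1 s y"
    using lower pos curv \<open>s \<noteq> 0\<close> by (simp add: aos BB1_def field_simps)
  ultimately show ?thesis
    using aos by (simp add: \<beta>_def B_bar_quadratic_form)
qed

end
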